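(* Let $n$ be a natural number. For every natural number $a$ with $\gcd(a,n)=1$, the bijection $\pi_a:\mathbb{Z}_n\to\mathbb{Z}_n$ defined by $\pi_a(x)=ax \pmod n$ has cycle type $$\mathrm{ctype}(\pi_a)=\prod_{d\mid n} x_{r_a(d)}^{\frac{\phi(d)}{r_a(d)}},$$ where the product is over all positive divisors $d$ of $n$. Accordingly, the cycle index of $\mathcal{U}_n$ acting on $\mathbb{Z}_n$ is $$\mathcal{Z}_{(\mathcal{U}_n,\mathbb{Z}_n)}=\frac{1}{\phi(n)}\sum_{a\in\mathcal{U}_n}\ \prod_{d\mid n} x_{r_a(d)}^{\frac{\phi(d)}{r_a(d)}}.$$
   Context: Natural numbers are positive integers; $\phi$ is Euler's phi function. $\mathbb{Z}_n$ is the set (additive group) of residues modulo $n$. $\mathcal{U}_n=\mathrm{Aut}(\mathbb{Z}_n)$ is identified with the set of residues $a$ modulo $n$ with $\gcd(a,n)=1$, where $a$ corresponds to the map $\pi_a(x)=ax \pmod n$; it acts on the $n$ points of $\mathbb{Z}_n$ by multiplication. For $\gcd(a,d)=1$, $r_a(d)=\min\{k\in\mathbb{N}: a^k\equiv 1 \pmod d\}$ is the multiplicative order of $a$ modulo $d$ (so $r_a(1)=1$). For a permutation $\pi$ of a finite set with $N$ elements, $\mathrm{ctype}(\pi)=\prod_{i=1}^N x_i^{\lambda_i(\pi)}$, where $x_1,x_2,\dots$ are formal indeterminates and $\lambda_i(\pi)$ is the number of cycles of length $i$ (fixed points counted as cycles of length 1) in the disjoint cycle decomposition of $\pi$. The cycle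 index of a finite permutation group $G$ on a finite set $P$ is $\mathcal{Z}_{(G,P)}=\frac{1}{|G|}\sum_{\pi\in G}\mathrm{ctype}(\pi)$. *)

theory Defs
  imports
    "HOL-Algebra.Algebra"
    "HOL-Combinatorics.Orbits"
    "HOL-Library.Poly_Mapping"
    "HOL-Number_Theory.Number_Theory"
begin

(* Polynomials with rational coefficients in the indeterminates x_0, x_1, x_2, ... (x_0 is never
   used below): finitely supported maps from exponent vectors to coefficients, with the
   convolution product of HOL-Library.Poly_Mapping. *)
type_synonym ratpoly = "(nat \<Rightarrow>\<^sub>0 nat) \<Rightarrow>\<^sub>0 rat"

definition indet :: "nat \<Rightarrow> ratpoly" where
  "indet i = Poly_Mapping.single (Poly_Mapping.single i 1) 1"

definition const_poly :: "rat \<Rightarrow> ratpoly" where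
  "const_poly c = Poly_Mapping.single 0 c"

(* A cycle of a permutation f of P is identified with the set of points it moves around; a fixed
   point x is the cycle {x}. *)
definition num_cycles :: "nat \<Rightarrow> ('a \<Rightarrow> 'a) \<Rightarrow> 'a set \<Rightarrow> nat" where
  "num_cycles i f P = card {C. C \<subseteq> P \<and> cyclic_on f C \<and> card C = i}"

definition ctype :: "('a \<Rightarrow> 'a) \<Rightarrow> 'a set \<Rightarrow> ratpoly" where
  "ctype f P = (\<Prod>i = 1..card P. indet i ^ num_cycles i f P)"

(* Intended for a finite set P and a group G of permutations of P given, as in HOL-Algebra's
   Bij, by functions that are extensional on P, so that distinct elements of G are distinct
   permutations. *)
definition cycle_index :: "('a \<Rightarrow> 'a) set \<Rightarrow> 'a set \<Rightarrow> ratpoly" where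
  "cycle_index G P = const_poly (1 / of_nat (card G)) * (\<Sum>f\<in>G. ctype f P)"

definition mult_map :: "nat \<Rightarrow> nat \<Rightarrow> int \<Rightarrow> int" where
  "mult_map n a = (\<lambda>x\<in>carrier (integer_mod_group n). (int a * x) mod int n)"

(* For n = 1 this is {0}. *)
definition unit_residues :: "nat \<Rightarrow> nat set" where
  "unit_residues n = {a \<in> {0..<n}. coprime a n}"

lemma mult_map_in_auto:
  assumes "n > 0" "coprime a n"
  shows "mult_map n a \<in> auto (integer_mod_group n)"
proof -
  let ?P = "carrier (integer_mod_group n)"
  have P: "?P = {0..<int n}" using assms by (simp add: carrier_integer_mod_group)
  have inj: "inj_on (mult_map n a) ?P"
  proof (rule inj_onI)
    fix x y assume xy: "x \<in> ?P" "y \<in> ?P" "mult_map n a x = mult_map n a y"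
    then have "[int a * x = int a * y] (mod int n)" by (simp add: mult_map_def cong_def)
    moreover have "coprime (int a) (int n)" using assms by simp
    ultimately have "[x = y] (mod int n)" using cong_mult_lcancel by blast
    then show "x = y" using xy P by (simp add: cong_def)
  qed
  have sub: "mult_map n a ` ?P \<subseteq> ?P" using assms by (auto simp: mult_map_def P)
  have "bij_betw (mult_map n a) ?P ?P"
    using inj sub P endo_inj_surj[of ?P "mult_map n a"] by (simp add: bij_betw_def)
  moreover have "mult_map n a \<in> hom (integer_mod_group n) (integer_mod_group n)"
    using assms by (auto simp: hom_def mult_map_def P mod_simps distrib_left)
  ultimately show ?thesis by (simp add: auto_def Bij_def mult_map_def)
qed

(* The identification of the automorphism group of the additive group of residues modulo n
   with the set of residues coprime to n. *)
lemma bij_betw_unit_residues_auto: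
  assumes "n > 0"
  shows "bij_betw (mult_map n) (unit_residues n) (auto (integer_mod_group n))"
proof (rule bij_betwI')
  let ?Z = "integer_mod_group n"
  let ?g = "1 mod int n"
  have P: "carrier ?Z = {0..<int n}" using assms by (simp add: carrier_integer_mod_group)
  have g: "?g \<in> carrier ?Z" using assms by (simp add: P)
  have at_g: "mult_map n a ?g = int a" if "a \<in> unit_residues n" for a
    using that g by (simp add: mult_map_def unit_residues_def mod_simps)
  show "(mult_map n a = mult_map n b) = (a = b)"
    if "a \<in> unit_residues n" "b \<in> unit_residues n" for a b
    using at_g that by (metis of_nat_eq_iff)
  show "mult_map n a \<in> auto ?Z" if "a \<in> unit_residues n" for a
    using that assms mult_map_in_auto by (simp add: unit_residues_def)
  show "\<exists>a\<in>unit_residues n. f = mult_map n a" if f: "f \<in> auto ?Z" for f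
  proof -
    have h: "f \<in> hom ?Z ?Z" and e: "f \<in> extensional (carrier ?Z)"
      and b: "bij_betw f (carrier ?Z) (carrier ?Z)"
      using f by (auto simp: auto_def Bij_def)
    have fg: "f ?g \<in> carrier ?Z" using b g by (auto simp: bij_betw_def)
    define a where "a = nat (f ?g)"
    have a: "int a = f ?g" "a < n" using fg by (auto simp: a_def P)
    have val: "f x = (int a * x) mod int n" if x: "x \<in> carrier ?Z" for x
    proof -
      interpret group_hom ?Z ?Z f
        by (simp add: group_hom_def group_hom_axioms_def h)
      have "x = ?g [^]\<^bsub>?Z\<^esub> nat x" using x by (simp add: P mod_simps)
      then have "f x = f ?g [^]\<^bsub>?Z\<^esub> nat x" using hom_nat_pow[OF g] by metis
      then show ?thesis using x a by (simp add: P mult.commute)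
    qed
    have "f = mult_map n a"
      by (rule extensionalityI[OF e]) (auto simp: mult_map_def val)
    moreover obtain x where "x \<in> carrier ?Z" "f x = ?g"
      using b g by (metis bij_betw_iff_bijections)
    then have "[int a * x = 1] (mod int n)" using val by (simp add: cong_def)
    then have "coprime (int a) (int n)" using coprime_iff_invertible_int by blast
    ultimately show ?thesis using a(2) by (auto simp: unit_residues_def)
  qed
qed

end

theory Submission
  imports Defs
begin

(* The residues x with gcd x n = n / d are the multiples of n / d by units modulo d. There are
   phi d of them, and a^k fixes such an x iff a^k = 1 modulo d. So they form a union of cycles
   of pi_a, all of length r_a(d). *)

section \<open>Cycles, orbits and the cycle type of a permutation\<close>

definition cycles :: "('a \<Rightarrow> 'a) \<Rightarrow> 'a set \<Rightarrow> 'a set set" where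
  "cycles f P = {C. C \<subseteq> P \<and> cyclic_on f C}"

lemma finite_cycles: "finite P \<Longrightarrow> finite (cycles f P)"
  unfolding cycles_def by (rule finite_subset[of _ "Pow P"]) auto

lemma orbit_subset_of_closed:
  assumes "f ` P \<subseteq> P" "x \<in> P"
  shows "orbit f x \<subseteq> P"
proof
  fix y assume "y \<in> orbit f x"
  then show "y \<in> P" by induct (use assms in auto)
qed

text \<open>\<open>orbit f x\<close> collects only the iterates with positive exponent, so a return
  to \<open>x\<close> has to be proved. Since \<open>f\<close> is controlled on \<open>P\<close>
  alone, it is first replaced by \<open>perm_restrict f P\<close>, a permutation of the whole type
  with the same orbits in \<open>P\<close>.\<close>

lemma self_in_orbit_of_bij_betw:
  assumes "finite P" "bij_betw f P P" "x \<in> P"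
  shows "x \<in> orbit f x"
proof -
  have "bij_betw (perm_restrict f P) P P"
    using assms(2) by (rule bij_betw_cong[THEN iffD1, rotated]) (simp add: perm_restrict_simps)
  then have "perm_restrict f P permutes P"
    by (auto intro: bij_imp_permutes simp: perm_restrict_simps)
  then have "x \<in> orbit (perm_restrict f P) x"
    using assms(1) permutation_permutes permutation_self_in_orbit by metis
  moreover have "orbit f x = orbit (perm_restrict f P) x"
    using assms by (intro orbit_cong0[of x P]) (auto simp: perm_restrict_simps bij_betw_def)
  ultimately show ?thesis by simp
qed

lemma cycles_eq_orbits:
  assumes "finite P" "bij_betw f P P"
  shows "cycles f P = orbit f ` P"
proof -
  have "f ` P \<subseteq> P" using assms by (simp add: bij_betw_def)
  then show ?thesis
    using self_in_orbit_of_bij_betw[OF assms] orbit_subset_of_closed[of f P]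
    by (fastforce simp: cycles_def cyclic_on_def image_iff)
qed

text \<open>Group the cycles by length. A cyclic set is nonempty and lies in \<open>P\<close>, so
  its length is within the range of the product in \<open>ctype\<close>.\<close>

lemma ctype_eq_prod_cycles:
  assumes "finite P"
  shows "ctype f P = (\<Prod>C\<in>cycles f P. indet (card C))"
proof -
  have "card C \<in> {1..card P}" if "C \<in> cycles f P" for C
    using that assms finite_subset[of C P]
    by (auto simp: cycles_def cyclic_on_def card_mono Suc_le_eq card_gt_0_iff)
  then have "(\<Prod>C\<in>cycles f P. indet (card C)) =
      (\<Prod>i=1..card P. \<Prod>C\<in>{C \<in> cycles f P. card C = i}. indet (card C))"
    using assms by (intro prod.group[symmetric]) (auto simp: finite_cycles)
  also have "\<dots> = ctype f P"
    unfolding ctype_def num_cycles_def cycles_def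
    by (intro prod.cong) (simp_all add: conj_assoc)
  finally show ?thesis by simp
qed

lemma card_cycles_uniform:
  assumes "finite P" "bij_betw f P P" "r > 0" "\<And>x. x \<in> P \<Longrightarrow> card (orbit f x) = r"
  shows "card (cycles f P) = card P div r"
proof -
  have C: "cycles f P = orbit f ` P" by (rule cycles_eq_orbits[OF assms(1,2)])
  have U: "\<Union> (cycles f P) = P"
    using self_in_orbit_of_bij_betw[OF assms(1,2)] unfolding C
    using orbit_subset_of_closed[of f P] assms(2) by (fastforce simp: bij_betw_def)
  have "r * card (cycles f P) = card (\<Union> (cycles f P))"
  proof (rule card_partition)
    show "finite (cycles f P)" "finite (\<Union> (cycles f P))"
      using assms(1) U by (auto simp: finite_cycles)
    show "card c = r" if "c \<in> cycles f P" for c using that C assms(4) by auto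
    \<comment> \<open>A cyclic set is the orbit of each of its points, so two cycles sharing a point
      coincide.\<close>
    show "c1 \<inter> c2 = {}" if "c1 \<in> cycles f P" "c2 \<in> cycles f P" "c1 \<noteq> c2" for c1 c2
      using that unfolding cycles_def cyclic_on_alldef by blast
  qed
  then show ?thesis using U assms(3) by (metis nonzero_mult_div_cancel_left neq0_conv)
qed

text \<open>An invariant block contains the whole orbit of each of its points, so the cycles on
  \<open>P\<close> are those on the blocks, and the product over cycles splits blockwise into powers
  of one indeterminate each.\<close>

lemma ctype_uniform_partition:
  assumes "finite P" "bij_betw f P P" "finite D"
    and P: "P = (\<Union>d\<in>D. L d)" and disj: "disjoint_family_on L D"
    and closed: "\<And>d. d \<in> D \<Longrightarrow> f ` L d \<subseteq> L d"
    and r: "\<And>d. d \<in> D \<Longrightarrow> r d > 0"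
      "\<And>d x. d \<in> D \<Longrightarrow> x \<in> L d \<Longrightarrow> card (orbit f x) = r d"
  shows "ctype f P = (\<Prod>d\<in>D. indet (r d) ^ (card (L d) div r d))"
proof -
  have fin: "finite (L d)" if "d \<in> D" for d
    using that assms(1) P by (auto intro: finite_subset)
  have bij: "bij_betw f (L d) (L d)" if "d \<in> D" for d
  proof -
    have "inj_on f (L d)"
      using that assms(2) P by (auto simp: bij_betw_def intro: inj_on_subset)
    then show ?thesis
      using fin closed that endo_inj_surj[of "L d" f] by (simp add: bij_betw_def)
  qed
  have eq: "cycles f P = (\<Union>d\<in>D. cycles f (L d))"
    using cycles_eq_orbits[OF assms(1,2)] cycles_eq_orbits[OF fin bij] by (auto simp: P)
  \<comment> \<open>Cycles are nonempty, hence none lies in two disjoint blocks.\<close>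
  have dj: "cycles f (L d) \<inter> cycles f (L e) = {}" if "d \<in> D" "e \<in> D" "d \<noteq> e" for d e
    using that disj by (fastforce simp: disjoint_family_on_def cycles_def cyclic_on_def)
  have "ctype f P = (\<Prod>d\<in>D. \<Prod>C\<in>cycles f (L d). indet (card C))"
    unfolding ctype_eq_prod_cycles[OF assms(1)] eq
    using assms(3) fin dj by (intro prod.UNION_disjoint) (auto simp: finite_cycles)
  also have "\<dots> = (\<Prod>d\<in>D. indet (r d) ^ (card (L d) div r d))"
  proof (intro prod.cong refl)
    fix d assume d: "d \<in> D"
    have "(\<Prod>C\<in>cycles f (L d). indet (card C)) = (\<Prod>C\<in>cycles f (L d). indet (r d))"
      using d r(2) by (intro prod.cong) (auto simp: cycles_eq_orbits[OF fin bij])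
    then show "(\<Prod>C\<in>cycles f (L d). indet (card C)) = indet (r d) ^ (card (L d) div r d)"
      using card_cycles_uniform[OF fin[OF d] bij[OF d] r(1)[OF d] r(2)[OF d]] by simp
  qed
  finally show ?thesis .
qed

section \<open>Orbit lengths under multiplication by a unit\<close>

lemma card_orbit_eq_period:
  assumes "x \<in> orbit f x" "\<And>k. (f ^^ k) x = x \<longleftrightarrow> r dvd k"
  shows "card (orbit f x) = r"
proof -
  \<comment> \<open>For \<open>r = 0\<close> the point would return only at time 0, whereas
    membership in its own orbit gives a positive return time.\<close>
  have r: "r > 0"
    using assms by (auto simp: orbit_altdef) (metis dvd_0_left_iff neq0_conv)
  have ne: "(f ^^ i) x \<noteq> (f ^^ j) x" if "i < j" "j < r" for i j
  proof
    assume "(f ^^ i) x = (f ^^ j) x"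
    \<comment> \<open>Another \<open>r - j\<close> steps turn the right side into
      \<open>(f ^^ r) x = x\<close>, so \<open>r\<close> would divide \<open>r - j + i\<close>, a
      number strictly between 0 and \<open>r\<close>.\<close>
    then have "(f ^^ (r - j + i)) x = (f ^^ (r - j + j)) x" by (simp only: funpow_add comp_apply)
    then have "r dvd r - j + i" using that assms(2)[of r] assms(2)[of "r - j + i"] by simp
    then show False using that by (auto dest: dvd_imp_le)
  qed
  have "inj_on (\<lambda>m. (f ^^ m) x) {..<r}"
    by (rule linorder_inj_onI') (use ne in auto)
  moreover have "orbit f x = (\<lambda>m. (f ^^ m) x) ` {..<r}"
    using assms(2)[of r] r by (subst orbit_altdef_bounded[of r]) auto
  ultimately show ?thesis by (simp add: card_image)
qed

lemma mult_map_funpow: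
  assumes "n > 0" "x \<in> {0..<int n}"
  shows "(mult_map n a ^^ k) x = (int a ^ k * x) mod int n"
proof (induction k)
  case 0
  then show ?case using assms by simp
next
  case (Suc k)
  then show ?case
    using assms by (simp add: mult_map_def carrier_integer_mod_group mod_simps mult.assoc)
qed

text \<open>With \<open>n = g * d\<close> and \<open>x = g * y\<close>, the factor \<open>g\<close>
  cancels from the condition that \<open>a^k\<close> fixes \<open>x\<close>, and then
  \<open>y\<close> cancels because it is a unit modulo \<open>d\<close>. What remains is
  \<open>a^k = 1\<close> modulo \<open>d\<close>.\<close>

lemma card_orbit_mult_map:
  assumes "n > 0" "coprime a n" "d dvd n" "x \<in> {0..<int n}" "gcd x (int n) = int (n div d)"
  shows "card (orbit (mult_map n a) x) = ord d a"
proof (rule card_orbit_eq_period)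
  show "x \<in> orbit (mult_map n a) x"
    using mult_map_in_auto[OF assms(1,2)] assms(1,4)
    by (intro self_in_orbit_of_bij_betw[of "{0..<int n}"])
       (auto simp: auto_def Bij_def carrier_integer_mod_group)
next
  fix k
  define g where "g = n div d"
  have n: "n = g * d" using assms(3) by (simp add: g_def)
  then have g: "g > 0" using assms(1) by (cases g) auto
  have gx: "gcd x (int n) = int g" using assms(5) by (simp add: g_def)
  then obtain y where y: "x = int g * y" by (metis dvdE gcd_dvd1)
  have "gcd x (int n) = int g * gcd y (int d)" by (simp add: y n gcd_mult_left)
  then have cop: "coprime y (int d)" using g gx by (simp add: coprime_iff_gcd_eq_1)
  have "(mult_map n a ^^ k) x = x \<longleftrightarrow> [int a ^ k * x = x] (mod int n)"
    using assms(1,4) by (simp add: mult_map_funpow cong_def)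
  also have "\<dots> \<longleftrightarrow> int g * int d dvd int g * ((int a ^ k - 1) * y)"
    by (simp add: cong_iff_dvd_diff y n algebra_simps)
  also have "\<dots> \<longleftrightarrow> int d dvd (int a ^ k - 1)"
    using g cop by (simp add: coprime_dvd_mult_left_iff coprime_commute)
  also have "\<dots> \<longleftrightarrow> [int (a ^ k) = int 1] (mod int d)" by (simp add: cong_iff_dvd_diff)
  also have "\<dots> \<longleftrightarrow> ord d a dvd k" by (simp only: cong_int_iff ord_divides)
  finally show "(mult_map n a ^^ k) x = x \<longleftrightarrow> ord d a dvd k" .
qed

section \<open>Counting residues by gcd, and the resulting formulas\<close>

lemma card_residues_gcd_eq:
  assumes "n > 0" "d dvd n"
  shows "card {x \<in> {0..<int n}. gcd x (int n) = int d} = totient (n div d)"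
proof -
  have "bij_betw (\<lambda>k. int k mod int n) {k \<in> {0<..n}. gcd k n = d}
          {x \<in> {0..<int n}. gcd x (int n) = int d}"
  \<comment> \<open>The known count runs over 1 to \<open>n\<close>, the residues over 0 to
    \<open>n - 1\<close>. Exchanging \<open>n\<close> with 0 preserves the gcd with
    \<open>n\<close>.\<close>
  proof (rule bij_betw_byWitness[where f' = "\<lambda>x. if x = 0 then n else nat x"])
    have m: "int k mod int n = (if k = n then 0 else int k)" if "k \<in> {0<..n}" for k
      using that by auto
    show "\<forall>k\<in>{k \<in> {0<..n}. gcd k n = d}.
        (if int k mod int n = 0 then n else nat (int k mod int n)) = k"
      using m by auto
    show "(\<lambda>k. int k mod int n) ` {k \<in> {0<..n}. gcd k n = d} \<subseteq>
        {x \<in> {0..<int n}. gcd x (int n) = int d}"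
      using assms(1) by auto
    show "(\<lambda>x. if x = 0 then n else nat x) ` {x \<in> {0..<int n}. gcd x (int n) = int d} \<subseteq>
        {k \<in> {0<..n}. gcd k n = d}"
    proof (intro image_subsetI)
      fix x assume x: "x \<in> {x \<in> {0..<int n}. gcd x (int n) = int d}"
      then obtain k where "x = int k" by (auto elim: nonneg_int_cases)
      then show "(if x = 0 then n else nat x) \<in> {k \<in> {0<..n}. gcd k n = d}"
        using x assms(1) by auto
    qed
  qed auto
  from bij_betw_same_card[OF this] show ?thesis using card_gcd_eq_totient[OF assms] by simp
qed

lemma ctype_mult_map:
  assumes "n > 0" "coprime a n"
  shows "ctype (mult_map n a) (carrier (integer_mod_group n)) =
           (\<Prod>d | d dvd n. indet (ord d a) ^ (totient d div ord d a))"
proof -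
  let ?P = "{0..<int n}" and ?f = "mult_map n a"
  \<comment> \<open>Indexing by the cofactor of the gcd makes \<open>d\<close> the modulus that
    governs both the size \<open>totient d\<close> and the orbit length \<open>ord d a\<close> of
    the block.\<close>
  define L where "L d = {x \<in> ?P. gcd x (int n) = int (n div d)}" for d
  have P: "carrier (integer_mod_group n) = ?P" using assms by (simp add: carrier_integer_mod_group)
  have "ctype ?f ?P = (\<Prod>d | d dvd n. indet (ord d a) ^ (card (L d) div ord d a))"
  proof (rule ctype_uniform_partition)
    show "bij_betw ?f ?P ?P"
      using mult_map_in_auto[OF assms] by (simp add: auto_def Bij_def P)
    show "finite {d. d dvd n}" using assms(1) by simp
    show "?P = (\<Union>d\<in>{d. d dvd n}. L d)"
    proof -
      have "\<exists>d. d dvd n \<and> x \<in> L d" if x: "x \<in> ?P" for x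
      proof -
        define g where "g = nat (gcd x (int n))"
        have g: "int g = gcd x (int n)" by (simp add: g_def)
        then have "g dvd n" by (metis gcd_dvd2 int_dvd_int_iff)
        then show ?thesis
          using x g assms(1) by (intro exI[of _ "n div g"]) (auto simp: L_def div_div_eq_right)
      qed
      then show ?thesis by (auto simp: L_def)
    qed
    show "disjoint_family_on L {d. d dvd n}"
    proof -
      \<comment> \<open>Taking cofactors is injective on the divisors of \<open>n\<close>, so
        distinct indices prescribe distinct gcds.\<close>
      have "d = e" if "d dvd n" "e dvd n" "n div d = n div e" for d e
        using that assms(1) by (metis dvd_div_mult_self mult_cancel_left neq0_conv mult_0)
      then show ?thesis by (auto simp: disjoint_family_on_def L_def)
    qed
    show "?f ` L d \<subseteq> L d" for d
    proof -
      \<comment> \<open>A factor coprime to \<open>n\<close> does not change the gcd with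
        \<open>n\<close>, which makes every block invariant.\<close>
      have "gcd (int a * x) (int n) = gcd x (int n)" for x
        using assms(2) by (intro gcd_mult_left_left_cancel) (simp add: coprime_commute)
      then show ?thesis
        using assms(1) by (auto simp: L_def mult_map_def P)
    qed
    show "ord d a > 0" if "d \<in> {d. d dvd n}" for d
      using that assms(2) by (auto simp: coprime_commute intro: coprime_divisors)
    show "card (orbit ?f x) = ord d a" if "d \<in> {d. d dvd n}" "x \<in> L d" for d x
      using that assms by (intro card_orbit_mult_map) (auto simp: L_def)
  qed simp
  moreover have "card (L d) = totient d" if "d dvd n" for d
    using that assms(1) card_residues_gcd_eq[of n "n div d"] by (auto simp: L_def)
  ultimately show ?thesis unfolding P by (auto intro: prod.cong)
qed

lemma card_unit_residues:
  assumes "n > 0"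
  shows "card (unit_residues n) = totient n"
\<comment> \<open>\<open>totatives n\<close> lies in 1 to \<open>n\<close>,
  \<open>unit_residues n\<close> in 0 to \<open>n - 1\<close>. For \<open>n > 1\<close> neither 0
  nor \<open>n\<close> is coprime to \<open>n\<close>, so the sets agree; for \<open>n = 1\<close>
  they are {1} and {0}.\<close>
proof (cases "n = 1")
  case False
  then have "k < n \<and> coprime k n \<longleftrightarrow> 0 < k \<and> k \<le> n \<and> coprime k n" for k
    by (cases "k = 0"; cases "k = n") auto
  have "a \<in> unit_residues n \<longleftrightarrow> a \<in> totatives n" for a
  proof (cases "a = 0 \<or> a = n")
    case True
    then show ?thesis
      using assms \<open>n \<noteq> 1\<close> by (auto simp: unit_residues_def in_totatives_iff)
  qed (auto simp: unit_residues_def in_totatives_iff)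
  then have "unit_residues n = totatives n" by blast
  then show ?thesis by (simp add: totient_def)
qed (simp add: unit_residues_def)

theorem corollary3p1:
  fixes n :: nat
  assumes "n > 0"
  shows "(\<forall>a::nat. a > 0 \<and> coprime a n \<longrightarrow>
            bij_betw (mult_map n a) (carrier (integer_mod_group n)) (carrier (integer_mod_group n)) \<and>
            ctype (mult_map n a) (carrier (integer_mod_group n)) =
              (\<Prod>d | d dvd n. indet (ord d a) ^ (totient d div ord d a))) \<and>
         cycle_index (auto (integer_mod_group n)) (carrier (integer_mod_group n)) =
           const_poly (1 / of_nat (totient n)) *
             (\<Sum>a\<in>unit_residues n. \<Prod>d | d dvd n. indet (ord d a) ^ (totient d div ord d a))"
proof (intro conjI allI impI)
  fix a assume a: "a > 0 \<and> coprime a n"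
  show "bij_betw (mult_map n a) (carrier (integer_mod_group n)) (carrier (integer_mod_group n))"
    using a assms mult_map_in_auto by (simp add: auto_def Bij_def)
  show "ctype (mult_map n a) (carrier (integer_mod_group n)) =
          (\<Prod>d | d dvd n. indet (ord d a) ^ (totient d div ord d a))"
    using a assms ctype_mult_map by simp
next
  let ?Z = "integer_mod_group n"
  \<comment> \<open>This bijection serves twice: it reindexes the sum over automorphisms, and it
    gives the group order in the normalising factor.\<close>
  have bij: "bij_betw (mult_map n) (unit_residues n) (auto ?Z)"
    by (rule bij_betw_unit_residues_auto[OF assms])
  have "(\<Sum>f\<in>auto ?Z. ctype f (carrier ?Z)) =
      (\<Sum>a\<in>unit_residues n. ctype (mult_map n a) (carrier ?Z))"
    by (rule sum.reindex_bij_betw[OF bij, symmetric])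
  also have "\<dots> = (\<Sum>a\<in>unit_residues n. \<Prod>d | d dvd n. indet (ord d a) ^ (totient d div ord d a))"
    using assms by (intro sum.cong) (auto simp: unit_residues_def ctype_mult_map)
  finally show "cycle_index (auto ?Z) (carrier ?Z) = const_poly (1 / of_nat (totient n)) *
      (\<Sum>a\<in>unit_residues n. \<Prod>d | d dvd n. indet (ord d a) ^ (totient d div ord d a))"
    using bij_betw_same_card[OF bij] card_unit_residues[OF assms] by (simp add: cycle_index_def)
qed

end
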